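(* Let $B$ be a complete Boolean algebra and let $C\subseteq B$ be a complete Boolean subalgebra (with the induced Boolean operations). Then $\mathsf{Log}_{\subseteq}^{\sharp}(B)\subseteq\mathsf{Log}_{\subseteq}^{\sharp}(C)$.
   Context: The propositional modal language has a countable set $\mathsf{Prop}$ of propositional variables, the Boolean connectives, $\Box$ and $\Diamond$. Boolean-valued models. For a complete Boolean algebra $B$ (bottom $0$, top $1$, complement $a^\ast$, $a\to b:=a^\ast\vee b$), define by transfinite recursion $V^{(B)}_\alpha=\{x: x$ is a function, $\mathrm{ran}(x)\subseteq B$, and $\mathrm{dom}(x)\subseteq V^{(B)}_\xi$ for some $\xi<\alpha\}$ and $V^{(B)}=\bigcup_\alpha V^{(B)}_\alpha$. $L_B$ is the first-order language of set theory expanded by a constant symbol for each element of $V^{(B)}$, and $\mathsf{Sent}(L_B)$ is the class of its sentences. The Boolean value $\llbracket\cdot\rrbracket_B:\mathsf{Sent}(L_B)\to B$ is defined recursively by $\llbracket u\in v\rrbracket_B=\bigvee_{x\in\mathrm{dom}(v)}(v(x)\wedge\llbracket x=u\rrbracket_B)$, $\llbracket u=v\rrbracket_B=\bigwedge_{x\in\mathrm{dom}(u)}(u(x)\to\llbracket x\in v\rrbracket_B)\wedge\bigwedge_{y\in\mathrm{dom}(v)}(v(y)\to\llbracket y\in u\rrbracket_B)$, the Boolean operations for the connectives, and meets (resp. joins) over $V^{(B)}$ for $\forall$ (resp. $\exists$). Translation models. $B^+:=B\setminus\{0\}$. A $B$-translation is a map $T:\mathsf{Prop}\to\mathsf{Sent}(L_B)$;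 it induces $v_T:\mathsf{Prop}\to B$, $v_T(p)=\llbracket T(p)\rrbracket_B$. For nonempty $W\subseteq B^+$, $M_{B,W,T}$ is the Kripke model with set of states $W$, accessibility $aRb\iff a\wedge b\neq 0$, and atomic satisfaction $M_{B,W,T},b\models p\iff b\le v_T(p)$; other connectives and modalities are interpreted by the usual Kripke clauses. $M_{B,W,T}\models\varphi$ means that $\varphi$ holds at every $b\in W$. $\mathsf{Log}_{\subseteq}^{\sharp}(B)$ is the set of modal formulas $\varphi$ such that $M_{B,W,T}\models\varphi$ for all nonempty $W\subseteq B^+$ and all $B$-translations $T$. A complete Boolean subalgebra of $B$ is a Boolean subalgebra (containing $0,1$) closed under arbitrary joins and meets computed in $B$. *)

theory Defs
  imports Complex_Main "HOL-Library.Countable" "HOL-Library.Equipollence"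
    "HOL-Library.Infinite_Typeclass" "HOL-Library.Multiset"
begin

text \<open>
  Complete Boolean algebras are types of sort \<open>{boolean_algebra, complete_lattice}\<close>. The library
  class \<open>complete_boolean_algebra\<close> demands complete distributivity and so covers only
  the atomic ones.
\<close>

definition complete_subalgebra :: "'b::{boolean_algebra, complete_lattice} set \<Rightarrow> bool" where
  "complete_subalgebra C \<longleftrightarrow>
     bot \<in> C \<and> top \<in> C \<and> (\<forall>a\<in>C. - a \<in> C) \<and>
     (\<forall>a\<in>C. \<forall>b\<in>C. inf a b \<in> C \<and> sup a b \<in> C) \<and>
     (\<forall>S. S \<subseteq> C \<longrightarrow> Sup S \<in> C \<and> Inf S \<in> C)"


section \<open>Hereditary sets of pairs\<close>

text \<open>
  HOL has no proper class of all sets. The background universe is represented by an arbitrary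
  infinite type \<open>'i\<close>, with limitation of size: a collection counts as a set iff it is strictly
  smaller than \<open>'i\<close>. If the cardinality of \<open>'i\<close> is a strongly inaccessible \<open>\<kappa>\<close> above that of
  the algebra, the names below are those of \<open>V\<^sup>(\<^sup>B\<^sup>)\<close> computed in the universe \<open>V\<^sub>\<kappa>\<close>.

  Members of \<open>('i, 'b) hset\<close> are the well-founded, extensional sets of pairs (earlier member,
  element of \<open>'b\<close>) with at most \<open>'i\<close> many elements; they are obtained as trees modulo
  the order and repetition of branches.
\<close>

datatype ('i, 'b) tree = Tree "'i \<Rightarrow> (('i, 'b) tree \<times> 'b) option"

fun branches :: "('i, 'b) tree \<Rightarrow> (('i, 'b) tree \<times> 'b) set" where
  "branches (Tree f) = {p. \<exists>i. f i = Some p}"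

inductive tree_eq :: "('i, 'b) tree \<Rightarrow> ('i, 'b) tree \<Rightarrow> bool" where
  "\<lbrakk>\<forall>(s, b) \<in> branches t. \<exists>s'. (s', b) \<in> branches t' \<and> tree_eq s s';
    \<forall>(s', b) \<in> branches t'. \<exists>s. (s, b) \<in> branches t \<and> tree_eq s s'\<rbrakk>
   \<Longrightarrow> tree_eq t t'"

lemma tree_branch_induct:
  assumes "\<And>t. (\<And>s b. (s, b) \<in> branches t \<Longrightarrow> P s) \<Longrightarrow> P t"
  shows "P t"
proof (induction t)
  case (Tree f)
  show ?case
  proof (rule assms)
    fix s b
    assume "(s, b) \<in> branches (Tree f)"
    then obtain i where i: "f i = Some (s, b)" by auto
    show "P s"
      by (rule Tree.IH[of "Some (s, b)" "(s, b)" s]) (auto simp: i[symmetric])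
  qed
qed

lemma tree_eq_refl: "tree_eq t t"
  by (induction t rule: tree_branch_induct) (rule tree_eq.intros; blast)

lemma tree_eq_sym: "tree_eq s t \<Longrightarrow> tree_eq t s"
  by (induction rule: tree_eq.induct) (rule tree_eq.intros; blast)

lemma tree_eq_trans: "tree_eq s t \<Longrightarrow> tree_eq t u \<Longrightarrow> tree_eq s u"
proof (induction s arbitrary: t u rule: tree_branch_induct)
  case (1 s)
  show ?case
  proof (rule tree_eq.intros)
    show "\<forall>(x, b)\<in>branches s. \<exists>z. (z, b) \<in> branches u \<and> tree_eq x z"
    proof safe
      fix x b assume x: "(x, b) \<in> branches s"
      with 1(2) obtain y where y: "(y, b) \<in> branches t" "tree_eq x y"
        by (cases rule: tree_eq.cases) blast
      with 1(3) obtain z where z: "(z, b) \<in> branches u" "tree_eq y z"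
        by (cases rule: tree_eq.cases) blast
      with 1(1)[OF x y(2)] show "\<exists>z. (z, b) \<in> branches u \<and> tree_eq x z" by blast
    qed
    show "\<forall>(z, b)\<in>branches u. \<exists>x. (x, b) \<in> branches s \<and> tree_eq x z"
    proof safe
      fix z b assume "(z, b) \<in> branches u"
      with 1(3) obtain y where y: "(y, b) \<in> branches t" "tree_eq y z"
        by (cases rule: tree_eq.cases) blast
      with 1(2) obtain x where x: "(x, b) \<in> branches s" "tree_eq x y"
        by (cases rule: tree_eq.cases) blast
      with 1(1)[OF x(1) x(2) y(2)] show "\<exists>x. (x, b) \<in> branches s \<and> tree_eq x z" by blast
    qed
  qed
qed

quotient_type ('i, 'b) hset = "('i, 'b) tree" / tree_eq
  by (rule equivpI; simp add: reflp_def symp_def transp_def)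
     (blast intro: tree_eq_refl tree_eq_sym tree_eq_trans)+

definition graph :: "('i, 'b) hset \<Rightarrow> (('i, 'b) hset \<times> 'b) set" where
  "graph x = map_prod abs_hset id ` branches (rep_hset x)"

lemma tree_eq_iff_abs_hset: "tree_eq s t \<longleftrightarrow> abs_hset s = abs_hset t"
  by (metis Quotient3_hset Quotient3_rel tree_eq_refl)

lemma abs_rep_hset: "abs_hset (rep_hset x) = x"
  by (metis Quotient3_hset Quotient3_abs_rep)

lemma graph_abs_hset: "graph (abs_hset t) = map_prod abs_hset id ` branches t"
proof -
  have "tree_eq (rep_hset (abs_hset t)) t"
    by (simp add: tree_eq_iff_abs_hset abs_rep_hset)
  then show ?thesis
  proof (cases rule: tree_eq.cases)
    case 1
    show ?thesis
    proof (rule set_eqI; clarify; rule iffI)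
      fix x b assume "(x, b) \<in> graph (abs_hset t)"
      then obtain s where "(s, b) \<in> branches (rep_hset (abs_hset t))" "x = abs_hset s"
        by (auto simp: graph_def)
      with 1(1) show "(x, b) \<in> map_prod abs_hset id ` branches t"
        by (force simp: tree_eq_iff_abs_hset)
    next
      fix x b assume "(x, b) \<in> map_prod abs_hset id ` branches t"
      then obtain s where s: "(s, b) \<in> branches t" "x = abs_hset s" by auto
      with 1(2) obtain s' where s': "(s', b) \<in> branches (rep_hset (abs_hset t))"
        "abs_hset s' = abs_hset s"
        by (force simp: tree_eq_iff_abs_hset)
      from imageI[OF s'(1), of "map_prod abs_hset id"] s(2) s'(2)
      show "(x, b) \<in> graph (abs_hset t)" by (simp add: graph_def)
    qed
  qed
qed

lemma graph_inject: "graph x = graph y \<longleftrightarrow> x = y"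
proof
  assume eq: "graph x = graph y"
  have "tree_eq (rep_hset x) (rep_hset y)"
  proof (rule tree_eq.intros; safe)
    fix s b assume "(s, b) \<in> branches (rep_hset x)"
    then have "(abs_hset s, b) \<in> graph y"
      unfolding eq[symmetric] by (force simp: graph_def)
    then show "\<exists>s'. (s', b) \<in> branches (rep_hset y) \<and> tree_eq s s'"
      by (force simp: graph_def tree_eq_iff_abs_hset)
  next
    fix s b assume "(s, b) \<in> branches (rep_hset y)"
    then have "(abs_hset s, b) \<in> graph x"
      unfolding eq by (force simp: graph_def)
    then show "\<exists>s'. (s', b) \<in> branches (rep_hset x) \<and> tree_eq s' s"
      by (force simp: graph_def tree_eq_iff_abs_hset)
  qed
  then show "x = y" by (simp add: tree_eq_iff_abs_hset abs_rep_hset)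
qed simp

lemma graph_surj:
  fixes g :: "(('i, 'b) hset \<times> 'b) set"
  assumes "g \<lesssim> (UNIV :: 'i set)"
  shows "\<exists>x. graph x = g"
proof -
  obtain h :: "('i, 'b) hset \<times> 'b \<Rightarrow> 'i" where h: "inj_on h g"
    using assms unfolding lepoll_def by blast
  define f where "f i = (if \<exists>p\<in>g. h p = i then
    Some (map_prod rep_hset id (inv_into g h i)) else None)" for i
  have "branches (Tree f) = map_prod rep_hset id ` g"
    using h by (force simp: f_def image_iff split: if_splits)
  then have "graph (abs_hset (Tree f)) = g"
    by (simp add: graph_abs_hset image_image prod.map_comp o_def abs_rep_hset
        del: branches.simps flip: id_def)
       (force simp: abs_rep_hset image_iff)
  then show ?thesis by blast
qed

definition hdom :: "('i, 'b) hset \<Rightarrow> ('i, 'b) hset set" where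
  "hdom x = Domain (graph x)"

definition happ :: "('i, 'b) hset \<Rightarrow> ('i, 'b) hset \<Rightarrow> 'b" where
  "happ x y = (THE b. (y, b) \<in> graph x)"

lemma wf_hdom: "wf {(y, x). y \<in> hdom x}"
proof (rule wfI_min, rule ccontr)
  fix x :: "('i, 'b) hset" and Q
  assume x: "x \<in> Q" and no: "\<not> (\<exists>z\<in>Q. \<forall>y. (y, z) \<in> {(y, x). y \<in> hdom x} \<longrightarrow> y \<notin> Q)"
  have "abs_hset t \<notin> Q" for t :: "('i, 'b) tree"
  proof (induction t rule: tree_branch_induct)
    case (1 t)
    show ?case
    proof
      assume "abs_hset t \<in> Q"
      with no obtain y where "y \<in> hdom (abs_hset t)" "y \<in> Q" by blast
      with 1 show False by (auto simp: hdom_def graph_abs_hset)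
    qed
  qed
  from this[of "rep_hset x"] x show False by (simp add: abs_rep_hset)
qed


section \<open>The Boolean-valued universe\<close>

definition functions_on ::
  "'b set \<Rightarrow> ('i::infinite, 'b) hset set \<Rightarrow> ('i, 'b) hset set" where
  "functions_on B X =
     {x. single_valued (graph x) \<and> hdom x \<prec> (UNIV :: 'i set) \<and> Range (graph x) \<subseteq> B \<and> hdom x \<subseteq> X}"

text \<open>
  \<open>V_stage B\<close> holds exactly of the levels \<open>V\<^sub>\<alpha>\<^sup>(\<^sup>B\<^sup>)\<close>: the recursion is
  \<open>V\<^sub>\<alpha>\<^sup>(\<^sup>B\<^sup>) = (\<Union>\<xi><\<alpha>. functions_on B V\<^sub>\<xi>\<^sup>(\<^sup>B\<^sup>))\<close>, and the set \<open>S\<close> of earlier levels takes the place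
  of the ordinal \<open>\<alpha>\<close>.
\<close>

inductive V_stage :: "'b set \<Rightarrow> ('i::infinite, 'b) hset set \<Rightarrow> bool" for B where
  "(\<forall>X\<in>S. V_stage B X) \<Longrightarrow> V_stage B (\<Union>X\<in>S. functions_on B X)"

definition V_names :: "'b set \<Rightarrow> ('i::infinite, 'b) hset set" where
  "V_names B = \<Union>{X. V_stage B X}"

lemma V_names_eq: "(V_names B :: ('i::infinite, 'b) hset set) = functions_on B (V_names B)" (is "?N = _")
proof
  show "?N \<subseteq> functions_on B ?N"
  proof
    fix x :: "('i, 'b) hset" assume "x \<in> ?N"
    then obtain X where "V_stage B X" "x \<in> X" by (auto simp: V_names_def)
    then obtain Y where "V_stage B Y" "x \<in> functions_on B Y" by (auto elim: V_stage.cases)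
    then show "x \<in> functions_on B ?N"
      by (auto simp: V_names_def functions_on_def)
  qed
next
  have mono: "X \<subseteq> Y \<Longrightarrow> functions_on B X \<subseteq> functions_on B Y"
    for X Y :: "('i, 'b) hset set"
    by (auto simp: functions_on_def)
  have V: "V_stage B (\<Union>X\<in>{X. V_stage B X}. functions_on B X :: ('i, 'b) hset set)"
    (is "V_stage B ?V")
    by (rule V_stage.intros) simp
  have "x \<in> ?V" if x: "x \<in> ?N" for x
  proof -
    obtain X where "V_stage B X" "x \<in> X" using x by (auto simp: V_names_def)
    then show ?thesis by (auto elim: V_stage.cases)
  qed
  then have "?N \<subseteq> ?V" by (rule subsetI)
  then have "functions_on B ?N \<subseteq> functions_on B ?V" by (rule mono)
  also have "\<dots> \<subseteq> ?V" using V by blast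
  also have "\<dots> \<subseteq> ?N" using V by (auto simp: V_names_def)
  finally show "functions_on B ?N \<subseteq> ?N" .
qed


section \<open>Boolean values\<close>

datatype 'n tm = Var nat | Const 'n

datatype 'n fm =
    Mem "'n tm" "'n tm"
  | Equal "'n tm" "'n tm"
  | Neg "'n fm"
  | Conj "'n fm" "'n fm"
  | Disj "'n fm" "'n fm"
  | Imp "'n fm" "'n fm"
  | All nat "'n fm"
  | Ex nat "'n fm"

fun tm_vars :: "'n tm \<Rightarrow> nat set" where
  "tm_vars (Var x) = {x}"
| "tm_vars (Const u) = {}"

fun free_vars :: "'n fm \<Rightarrow> nat set" where
  "free_vars (Mem s t) = tm_vars s \<union> tm_vars t"
| "free_vars (Equal s t) = tm_vars s \<union> tm_vars t"
| "free_vars (Neg \<phi>) = free_vars \<phi>"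
| "free_vars (Conj \<phi> \<psi>) = free_vars \<phi> \<union> free_vars \<psi>"
| "free_vars (Disj \<phi> \<psi>) = free_vars \<phi> \<union> free_vars \<psi>"
| "free_vars (Imp \<phi> \<psi>) = free_vars \<phi> \<union> free_vars \<psi>"
| "free_vars (All x \<phi>) = free_vars \<phi> - {x}"
| "free_vars (Ex x \<phi>) = free_vars \<phi> - {x}"

text \<open>The set of constants of a formula is \<open>set_fm\<close>, provided by the datatype package.\<close>

definition Sent :: "'b set \<Rightarrow> ('i::infinite, 'b) hset fm set" where
  "Sent B = {\<phi>. free_vars \<phi> = {} \<and> set_fm \<phi> \<subseteq> V_names B}"

fun subst_tm :: "nat \<Rightarrow> 'n \<Rightarrow> 'n tm \<Rightarrow> 'n tm" where
  "subst_tm x u (Var y) = (if y = x then Const u else Var y)"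
| "subst_tm x u (Const v) = Const v"

fun subst :: "nat \<Rightarrow> 'n \<Rightarrow> 'n fm \<Rightarrow> 'n fm" where
  "subst x u (Mem s t) = Mem (subst_tm x u s) (subst_tm x u t)"
| "subst x u (Equal s t) = Equal (subst_tm x u s) (subst_tm x u t)"
| "subst x u (Neg \<phi>) = Neg (subst x u \<phi>)"
| "subst x u (Conj \<phi> \<psi>) = Conj (subst x u \<phi>) (subst x u \<psi>)"
| "subst x u (Disj \<phi> \<psi>) = Disj (subst x u \<phi>) (subst x u \<psi>)"
| "subst x u (Imp \<phi> \<psi>) = Imp (subst x u \<phi>) (subst x u \<psi>)"
| "subst x u (All y \<phi>) = All y (if y = x then \<phi> else subst x u \<phi>)"
| "subst x u (Ex y \<phi>) = Ex y (if y = x then \<phi> else subst x u \<phi>)"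

lemma size_subst_tm [simp]: "size (subst_tm x u t) = size t"
  by (cases t) auto

lemma size_subst [simp]: "size (subst x u \<phi>) = size \<phi>"
  by (induction \<phi>) auto

function bv_mem :: "('i, 'b::{boolean_algebra, complete_lattice}) hset \<Rightarrow> ('i, 'b) hset \<Rightarrow> 'b"
  and bv_eq :: "('i, 'b) hset \<Rightarrow> ('i, 'b) hset \<Rightarrow> 'b" where
  "bv_mem u v = (SUP x\<in>hdom v. inf (happ v x) (bv_eq x u))"
| "bv_eq u v = inf (INF x\<in>hdom u. sup (- happ u x) (bv_mem x v))
                   (INF y\<in>hdom v. sup (- happ v y) (bv_mem y u))"
  by pat_completeness auto
termination
proof (relation "inv_image (mult {(y, x). y \<in> hdom x})
    (\<lambda>a. case a of Inl (u, v) \<Rightarrow> {#u, v#} | Inr (u, v) \<Rightarrow> {#u, v#})")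
  show "wf (inv_image (mult {(y, x). y \<in> hdom x})
    (\<lambda>a. case a of Inl (u, v) \<Rightarrow> {#u, v#} | Inr (u, v) \<Rightarrow> {#u :: ('i, 'b) hset, v#}))"
    by (intro wf_inv_image wf_mult wf_hdom)
  have step: "({#x, w#}, {#y, w#}) \<in> mult {(y, x). y \<in> hdom x}"
    if "x \<in> hdom y" for x y w :: "('i, 'b) hset"
    using that one_step_implies_mult[of "{#y#}" "{#x#}" "{(y, x). y \<in> hdom x}" "{#w#}"]
    by (simp add: add_mset_commute)
  show "(Inr (x, u), Inl (u, v)) \<in> inv_image (mult {(y, x). y \<in> hdom x})
    (\<lambda>a. case a of Inl (u, v) \<Rightarrow> {#u, v#} | Inr (u, v) \<Rightarrow> {#u, v#})"
    if "x \<in> hdom v" for u v x :: "('i, 'b) hset"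
    using step[OF that, of u] by (simp add: add_mset_commute)
  show "(Inl (x, v), Inr (u, v)) \<in> inv_image (mult {(y, x). y \<in> hdom x})
    (\<lambda>a. case a of Inl (u, v) \<Rightarrow> {#u, v#} | Inr (u, v) \<Rightarrow> {#u, v#})"
    if "x \<in> hdom u" for u v x :: "('i, 'b) hset"
    using step[OF that, of v] by simp
  show "(Inl (y, u), Inr (u, v)) \<in> inv_image (mult {(y, x). y \<in> hdom x})
    (\<lambda>a. case a of Inl (u, v) \<Rightarrow> {#u, v#} | Inr (u, v) \<Rightarrow> {#u, v#})"
    if "y \<in> hdom v" for u v y :: "('i, 'b) hset"
    using step[OF that, of u] by (simp add: add_mset_commute)
qed

text \<open>
  The carrier \<open>B\<close> is intended to be the whole type or a complete subalgebra of it, so joins and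
  meets in \<open>B\<close> agree with those of the type. Atomic formulas with variables are not closed;
  they never arise from a sentence.
\<close>

function bool_val ::
  "'b::{boolean_algebra, complete_lattice} set \<Rightarrow> ('i::infinite, 'b) hset fm \<Rightarrow> 'b" where
  "bool_val B (Mem s t) = (case (s, t) of (Const u, Const v) \<Rightarrow> bv_mem u v | _ \<Rightarrow> undefined)"
| "bool_val B (Equal s t) = (case (s, t) of (Const u, Const v) \<Rightarrow> bv_eq u v | _ \<Rightarrow> undefined)"
| "bool_val B (Neg \<phi>) = - bool_val B \<phi>"
| "bool_val B (Conj \<phi> \<psi>) = inf (bool_val B \<phi>) (bool_val B \<psi>)"
| "bool_val B (Disj \<phi> \<psi>) = sup (bool_val B \<phi>) (bool_val B \<psi>)"
| "bool_val B (Imp \<phi> \<psi>) = sup (- bool_val B \<phi>) (bool_val B \<psi>)"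
| "bool_val B (All x \<phi>) = (INF u\<in>V_names B. bool_val B (subst x u \<phi>))"
| "bool_val B (Ex x \<phi>) = (SUP u\<in>V_names B. bool_val B (subst x u \<phi>))"
  by pat_completeness auto
termination
  by (relation "measure (\<lambda>(B, \<phi>). size \<phi>)") auto


section \<open>Modal logic and translation models\<close>

datatype 'p mfm =
    MVar 'p
  | MBot
  | MNeg "'p mfm"
  | MConj "'p mfm" "'p mfm"
  | MDisj "'p mfm" "'p mfm"
  | MImp "'p mfm" "'p mfm"
  | MBox "'p mfm"
  | MDia "'p mfm"

text \<open>Satisfaction in the Kripke model with states \<open>W\<close>, accessibility \<open>R\<close> and atomic
  satisfaction \<open>A\<close>.\<close>

fun sat :: "'w set \<Rightarrow> ('w \<Rightarrow> 'w \<Rightarrow> bool) \<Rightarrow> ('w \<Rightarrow> 'p \<Rightarrow> bool) \<Rightarrow> 'w \<Rightarrow> 'p mfm \<Rightarrow> bool" where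
  "sat W R A w (MVar p) \<longleftrightarrow> A w p"
| "sat W R A w MBot \<longleftrightarrow> False"
| "sat W R A w (MNeg \<phi>) \<longleftrightarrow> \<not> sat W R A w \<phi>"
| "sat W R A w (MConj \<phi> \<psi>) \<longleftrightarrow> sat W R A w \<phi> \<and> sat W R A w \<psi>"
| "sat W R A w (MDisj \<phi> \<psi>) \<longleftrightarrow> sat W R A w \<phi> \<or> sat W R A w \<psi>"
| "sat W R A w (MImp \<phi> \<psi>) \<longleftrightarrow> (sat W R A w \<phi> \<longrightarrow> sat W R A w \<psi>)"
| "sat W R A w (MBox \<phi>) \<longleftrightarrow> (\<forall>v\<in>W. R w v \<longrightarrow> sat W R A v \<phi>)"
| "sat W R A w (MDia \<phi>) \<longleftrightarrow> (\<exists>v\<in>W. R w v \<and> sat W R A v \<phi>)"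

definition translation :: "'b set \<Rightarrow> ('p \<Rightarrow> ('i::infinite, 'b) hset fm) \<Rightarrow> bool" where
  "translation B T \<longleftrightarrow> (\<forall>p. T p \<in> Sent B)"

definition valuation ::
  "'b::{boolean_algebra, complete_lattice} set \<Rightarrow> ('p \<Rightarrow> ('i::infinite, 'b) hset fm) \<Rightarrow> 'p \<Rightarrow> 'b" where
  "valuation B T p = bool_val B (T p)"

definition model_valid ::
  "'b::{boolean_algebra, complete_lattice} set \<Rightarrow> 'b set \<Rightarrow>
   ('p \<Rightarrow> ('i::infinite, 'b) hset fm) \<Rightarrow> 'p mfm \<Rightarrow> bool" where
  "model_valid B W T \<phi> \<longleftrightarrow>
     (\<forall>b\<in>W. sat W (\<lambda>a b. inf a b \<noteq> bot) (\<lambda>b p. b \<le> valuation B T p) b \<phi>)"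

definition Log_sub_sharp ::
  "'i::infinite itself \<Rightarrow> 'b::{boolean_algebra, complete_lattice} set \<Rightarrow> 'p::countable mfm set" where
  "Log_sub_sharp _ B =
     {\<phi>. \<forall>W (T :: 'p \<Rightarrow> ('i, 'b) hset fm).
        W \<noteq> {} \<and> W \<subseteq> B - {bot} \<and> translation B T \<longrightarrow> model_valid B W T \<phi>}"

end

theory Submission
  imports Defs
begin

text \<open>
  Every element \<open>b\<close> of a complete Boolean algebra is the Boolean value of a sentence, namely of
  \<open>\<emptyset> \<in> {(\<emptyset>, b)}\<close>. So every valuation into \<open>C\<close> is induced by a translation for the larger
  algebra, and the models over \<open>C\<close> are among the models over the larger algebra.
\<close>

text \<open>By the fixed-point equation, membership is a one-step check on the graph, with no stage
  to exhibit.\<close>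

lemma V_namesI:
  fixes x :: "('i::infinite, 'b) hset"
  assumes "single_valued (graph x)" "hdom x \<prec> (UNIV :: 'i set)"
    "Range (graph x) \<subseteq> B" "hdom x \<subseteq> V_names B"
  shows "x \<in> V_names B"
  using assms by (subst V_names_eq) (simp add: functions_on_def)

lemma exists_sentence_with_value:
  fixes b :: "'b::{boolean_algebra, complete_lattice}"
  assumes "b \<in> B"
  shows "\<exists>\<phi> :: ('i::infinite, 'b) hset fm. \<phi> \<in> Sent B \<and> bool_val B \<phi> = b"
proof -
  obtain e :: "('i, 'b) hset" where e: "graph e = {}"
    using graph_surj[of "{}"] by (auto simp: lepoll_def)
  have "{(e, b)} \<lesssim> (UNIV :: 'i set)"
    by (auto simp: lepoll_def)
  then obtain u where u: "graph u = {(e, b)}"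
    using graph_surj by blast
  have dom: "hdom e = {}" "hdom u = {e}"
    using e u by (auto simp: hdom_def)
  \<comment> \<open>The domains of \<open>e\<close> and \<open>u\<close> are finite, hence strictly
    smaller than the infinite type \<open>'i\<close>.\<close>
  have eN: "e \<in> V_names B"
    by (rule V_namesI) (simp_all add: e dom finite_lesspoll_infinite infinite_UNIV)
  have uN: "u \<in> V_names B"
    by (rule V_namesI) (simp_all add: u dom eN assms finite_lesspoll_infinite infinite_UNIV single_valued_def)
  have "happ u e = b"
    by (simp add: happ_def u)
  \<comment> \<open>Both meets run over the empty domain. The mutually recursive equations are
    unfolded once by \<open>subst\<close>, since as simp rules they would loop.\<close>
  moreover have "bv_eq e e = top"
    by (subst bv_eq.simps) (simp add: dom del: bv_eq.simps bv_mem.simps)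
  \<comment> \<open>The join has the single term \<open>inf b top\<close>.\<close>
  ultimately have "bv_mem e u = b"
    by (subst bv_mem.simps) (simp add: dom del: bv_eq.simps bv_mem.simps)
  then have "bool_val B (Mem (Const e) (Const u)) = b"
    by (simp del: bv_eq.simps bv_mem.simps)
  moreover have "Mem (Const e) (Const u) \<in> Sent B"
    using eN uN by (simp add: Sent_def)
  ultimately show ?thesis by blast
qed

lemma exists_translation_with_valuation:
  fixes v :: "'p \<Rightarrow> 'b::{boolean_algebra, complete_lattice}"
  assumes "range v \<subseteq> B"
  shows "\<exists>T :: 'p \<Rightarrow> ('i::infinite, 'b) hset fm. translation B T \<and> valuation B T = v"
proof -
  have "\<exists>\<phi> :: ('i, 'b) hset fm. \<phi> \<in> Sent B \<and> bool_val B \<phi> = v p" for p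
    using assms by (intro exists_sentence_with_value) blast
  then obtain T :: "'p \<Rightarrow> ('i, 'b) hset fm"
    where "\<And>p. T p \<in> Sent B \<and> bool_val B (T p) = v p"
    by metis
  then show ?thesis
    by (auto simp: translation_def valuation_def fun_eq_iff)
qed

theorem proposition6p9:
  fixes C :: "'b::{boolean_algebra, complete_lattice} set"
  assumes "complete_subalgebra C"
  shows "(Log_sub_sharp TYPE('i::infinite) (UNIV :: 'b set) :: 'p::countable mfm set)
           \<subseteq> Log_sub_sharp TYPE('i) C"
proof
  fix \<phi> :: "'p mfm"
  assume \<phi>: "\<phi> \<in> Log_sub_sharp TYPE('i) (UNIV :: 'b set)"
  have "model_valid C W T \<phi>"
    if W: "W \<noteq> {}" "W \<subseteq> C - {bot}"
    for W and T :: "'p \<Rightarrow> ('i, 'b) hset fm"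
  proof -
    \<comment> \<open>\<open>T\<close> itself may take other values over \<open>UNIV\<close>, as its
      quantifiers then range over more names; only its values over \<open>C\<close> are carried
      over.\<close>
    obtain T' :: "'p \<Rightarrow> ('i, 'b) hset fm"
      where T': "translation UNIV T'" "valuation UNIV T' = valuation C T"
      using exists_translation_with_valuation[of "valuation C T" UNIV] by auto
    have "W \<subseteq> UNIV - {bot}"
      using W by blast
    then have "model_valid UNIV W T' \<phi>"
      using \<phi> W T' by (simp add: Log_sub_sharp_def)
    \<comment> \<open>Satisfaction depends only on \<open>W\<close> and the valuation, so both
      translations give the same Kripke model.\<close>
    then show ?thesis
      by (simp add: model_valid_def T')
  qed
  then show "\<phi> \<in> Log_sub_sharp TYPE('i) C"
    by (simp add: Log_sub_sharp_def)
qed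

end
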